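(* Let $\lambda$ be a wide partition and let $G=L(G_\lambda)$. Then the set of rows of the Young diagram of $\lambda$ (each row viewed as a complete subgraph of $G$) is a completely saturated clique cover of $G$. Moreover, $G$ satisfies $\Delta$-conjugacy and the t-phenomenon.
   Context: For partitions $\alpha,\beta$ of the same integer, $\alpha\ge\beta$ (dominance order) means $\sum_{k=1}^j\alpha_k\ge\sum_{k=1}^j\beta_k$ for all $j$ (parts padded by zeros); $\mu'$ is the conjugate of $\mu$. A partition $\mu$ is a subpartition of $\lambda$ if the multiset of parts of $\mu$ is a submultiset of the multiset of parts of $\lambda$ (equivalently, the Young diagram of $\mu$ is obtained by deleting some rows of that of $\lambda$). $\lambda$ is wide if $\mu\ge\mu'$ for every subpartition $\mu$ of $\lambda$. $G_\lambda$ is the bipartite graph whose vertices are the rows and the columns of the Young diagram of $\lambda$, with an edge between row $i$ and column $j$ iff $j\le\lambda_i$; $L(G_\lambda)$ is its line graph, whose vertices are the cells of the Young diagram, two cells adjacent iff they lie in the same row or same column. For a graph $G$: a $k$-clique is a union of $k$ complete subgraphs, a $k$-stable set a union of $k$ stable sets; $\omega_k$ (resp. $\alpha_k$) is the maximum number of vertices of a $k$-clique (resp. $k$-stable set), $\omega_0=\alpha_0=0$, $\Delta\omega_k=\omega_k-\omega_{k-1}$, $\Delta\alpha_k=\alpha_k-\alpha_{k-1}$. $G$ satisfies $\Delta$-conjugacy if $\Delta\omega$ and $\Delta\alpha$ are both nonincreasing (hence partitions) and are conjugate to each other. A clique cover (resp. stable set cover) is a family of vertex-disjoint complete subgraphs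 (resp. stable sets) covering all vertices; its sizes sorted decreasingly form a partition, also denoted by the cover's name. A clique cover $\nu$ is $k$-saturated if $\alpha_k=\sum_{i=1}^k\nu'_i$; a stable set cover $\nu$ is $k$-saturated if $\omega_k=\sum_{i=1}^k\nu'_i$; a cover is completely saturated if it is $k$-saturated for all positive integers $k$. $G$ satisfies the t-phenomenon if for every positive integer $k$ there is a clique cover that is both $k$-saturated and $(k+1)$-saturated, and a stable set cover that is both $k$-saturated and $(k+1)$-saturated. *)

theory Defs
  imports "HOL-Library.Multiset" "HOL-Library.Disjoint_Sets" "HOL-Library.Ramsey"
begin

section \<open>Integer partitions\<close>

definition is_partition :: "nat list \<Rightarrow> bool" where
  "is_partition p \<longleftrightarrow> sorted_wrt (\<ge>) p \<and> 0 \<notin> set p"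

text \<open>Parts are numbered from 1 and padded by zeros.\<close>

definition part :: "nat list \<Rightarrow> nat \<Rightarrow> nat" where
  "part p k = (if 1 \<le> k \<and> k \<le> length p then p ! (k - 1) else 0)"

definition conjugate :: "nat list \<Rightarrow> nat list" where
  "conjugate p = map (\<lambda>j. length (filter (\<lambda>a. j \<le> a) p)) [1..<Suc (part p 1)]"

definition dominates :: "nat list \<Rightarrow> nat list \<Rightarrow> bool" where
  "dominates a b \<longleftrightarrow>
     sum_list a = sum_list b \<and> (\<forall>j. (\<Sum>k = 1..j. part a k) \<ge> (\<Sum>k = 1..j. part b k))"

definition subpartition :: "nat list \<Rightarrow> nat list \<Rightarrow> bool" where
  "subpartition mu lam \<longleftrightarrow> is_partition mu \<and> mset mu \<subseteq># mset lam"

definition wide :: "nat list \<Rightarrow> bool" where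
  "wide lam \<longleftrightarrow> (\<forall>mu. subpartition mu lam \<longrightarrow> dominates mu (conjugate mu))"

section \<open>Graphs\<close>

text \<open>A simple graph is a pair of a vertex set and a set of two-element edges.\<close>

type_synonym 'a graph = "'a set \<times> 'a set set"

abbreviation verts :: "'a graph \<Rightarrow> 'a set" where "verts \<equiv> fst"
abbreviation edges :: "'a graph \<Rightarrow> 'a set set" where "edges \<equiv> snd"

definition line_graph :: "'a graph \<Rightarrow> 'a set graph" where
  "line_graph G =
     (edges G, {{e, f} | e f. e \<in> edges G \<and> f \<in> edges G \<and> e \<noteq> f \<and> e \<inter> f \<noteq> {}})"

text \<open>The complete subgraphs (stable sets) in the union may be empty or repeated.\<close>

definition k_clique :: "'a graph \<Rightarrow> nat \<Rightarrow> 'a set \<Rightarrow> bool" where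
  "k_clique G k S \<longleftrightarrow>
     (\<exists>C. (\<forall>i<k. C i \<subseteq> verts G \<and> clique (C i) (edges G)) \<and> S = (\<Union>i<k. C i))"

definition k_stable :: "'a graph \<Rightarrow> nat \<Rightarrow> 'a set \<Rightarrow> bool" where
  "k_stable G k S \<longleftrightarrow>
     (\<exists>C. (\<forall>i<k. C i \<subseteq> verts G \<and> indep (C i) (edges G)) \<and> S = (\<Union>i<k. C i))"

definition omega :: "'a graph \<Rightarrow> nat \<Rightarrow> nat" where
  "omega G k = Max (card ` {S. k_clique G k S})"

definition alpha :: "'a graph \<Rightarrow> nat \<Rightarrow> nat" where
  "alpha G k = Max (card ` {S. k_stable G k S})"

text \<open>Only the values at \<open>k \<ge> 1\<close> are meaningful. The subtraction on \<open>nat\<close> does not truncate when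
  the graph is finite: see \<open>omega_mono\<close> and \<open>alpha_mono\<close> below.\<close>

definition delta_omega :: "'a graph \<Rightarrow> nat \<Rightarrow> nat" where
  "delta_omega G k = omega G k - omega G (k - 1)"

definition delta_alpha :: "'a graph \<Rightarrow> nat \<Rightarrow> nat" where
  "delta_alpha G k = alpha G k - alpha G (k - 1)"

definition delta_conjugacy :: "'a graph \<Rightarrow> bool" where
  "delta_conjugacy G \<longleftrightarrow>
     (\<forall>k\<ge>1. delta_omega G (k + 1) \<le> delta_omega G k) \<and>
     (\<forall>k\<ge>1. delta_alpha G (k + 1) \<le> delta_alpha G k) \<and>
     (\<exists>p q. is_partition p \<and> is_partition q \<and>
        (\<forall>k\<ge>1. part p k = delta_omega G k) \<and>
        (\<forall>k\<ge>1. part q k = delta_alpha G k) \<and>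
        q = conjugate p)"

definition clique_cover :: "'a graph \<Rightarrow> 'a set set \<Rightarrow> bool" where
  "clique_cover G C \<longleftrightarrow> partition_on (verts G) C \<and> (\<forall>K\<in>C. clique K (edges G))"

definition stable_cover :: "'a graph \<Rightarrow> 'a set set \<Rightarrow> bool" where
  "stable_cover G C \<longleftrightarrow> partition_on (verts G) C \<and> (\<forall>K\<in>C. indep K (edges G))"

definition cover_shape :: "'a set set \<Rightarrow> nat list" where
  "cover_shape C = rev (sorted_list_of_multiset (image_mset card (mset_set C)))"

definition saturated_clique_cover :: "'a graph \<Rightarrow> nat \<Rightarrow> 'a set set \<Rightarrow> bool" where
  "saturated_clique_cover G k C \<longleftrightarrow>
     clique_cover G C \<and> alpha G k = (\<Sum>i = 1..k. part (conjugate (cover_shape C)) i)"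

definition saturated_stable_cover :: "'a graph \<Rightarrow> nat \<Rightarrow> 'a set set \<Rightarrow> bool" where
  "saturated_stable_cover G k C \<longleftrightarrow>
     stable_cover G C \<and> omega G k = (\<Sum>i = 1..k. part (conjugate (cover_shape C)) i)"

definition completely_saturated_clique_cover :: "'a graph \<Rightarrow> 'a set set \<Rightarrow> bool" where
  "completely_saturated_clique_cover G C \<longleftrightarrow> (\<forall>k\<ge>1. saturated_clique_cover G k C)"

definition t_phenomenon :: "'a graph \<Rightarrow> bool" where
  "t_phenomenon G \<longleftrightarrow>
     (\<forall>k\<ge>1.
        (\<exists>C. saturated_clique_cover G k C \<and> saturated_clique_cover G (k + 1) C) \<and>
        (\<exists>C. saturated_stable_cover G k C \<and> saturated_stable_cover G (k + 1) C))"

lemma k_clique_subset: "k_clique G k S \<Longrightarrow> S \<subseteq> verts G"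
  by (fastforce simp: k_clique_def)

lemma k_stable_subset: "k_stable G k S \<Longrightarrow> S \<subseteq> verts G"
  by (fastforce simp: k_stable_def)

lemma k_clique_Suc: "k_clique G k S \<Longrightarrow> k_clique G (Suc k) S"
  unfolding k_clique_def
proof (elim exE conjE)
  fix C assume C: "\<forall>i<k. C i \<subseteq> verts G \<and> clique (C i) (edges G)" "S = (\<Union>i<k. C i)"
  then show "\<exists>C. (\<forall>i<Suc k. C i \<subseteq> verts G \<and> clique (C i) (edges G)) \<and> S = (\<Union>i<Suc k. C i)"
    by (intro exI[of _ "C(k := {})"]) (auto simp: less_Suc_eq lessThan_Suc)
qed

lemma k_stable_Suc: "k_stable G k S \<Longrightarrow> k_stable G (Suc k) S"
  unfolding k_stable_def
proof (elim exE conjE)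
  fix C assume C: "\<forall>i<k. C i \<subseteq> verts G \<and> indep (C i) (edges G)" "S = (\<Union>i<k. C i)"
  then show "\<exists>C. (\<forall>i<Suc k. C i \<subseteq> verts G \<and> indep (C i) (edges G)) \<and> S = (\<Union>i<Suc k. C i)"
    by (intro exI[of _ "C(k := {})"]) (auto simp: less_Suc_eq lessThan_Suc)
qed

lemma omega_0: "omega G 0 = 0" and alpha_0: "alpha G 0 = 0"
  by (simp_all add: omega_def alpha_def k_clique_def k_stable_def)

lemma k_clique_empty: "k_clique G k {}"
  unfolding k_clique_def by (rule exI[of _ "\<lambda>_. {}"]) simp

lemma k_stable_empty: "k_stable G k {}"
  unfolding k_stable_def by (rule exI[of _ "\<lambda>_. {}"]) simp

lemma omega_mono:
  assumes "finite (verts G)"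
  shows "omega G k \<le> omega G (Suc k)"
proof -
  have "finite {S. k_clique G (Suc k) S}"
    by (rule finite_subset[of _ "Pow (verts G)"]) (use assms in \<open>auto dest!: k_clique_subset\<close>)
  then show ?thesis
    unfolding omega_def using k_clique_empty k_clique_Suc by (intro Max_mono) blast+
qed

lemma alpha_mono:
  assumes "finite (verts G)"
  shows "alpha G k \<le> alpha G (Suc k)"
proof -
  have "finite {S. k_stable G (Suc k) S}"
    by (rule finite_subset[of _ "Pow (verts G)"]) (use assms in \<open>auto dest!: k_stable_subset\<close>)
  then show ?thesis
    unfolding alpha_def using k_stable_empty k_stable_Suc by (intro Max_mono) blast+
qed

section \<open>The graph of a Young diagram\<close>

datatype line = Row nat | Col nat

text \<open>The cell in row \<open>i\<close> and column \<open>j\<close> is the edge joining that row and that column, so the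
  cells of the diagram are the vertices of the line graph.\<close>

definition cell :: "nat \<Rightarrow> nat \<Rightarrow> line set" where
  "cell i j = {Row i, Col j}"

definition young_graph :: "nat list \<Rightarrow> line graph" where
  "young_graph lam =
     (Row ` {1..length lam} \<union> Col ` {1..part lam 1},
      {cell i j | i j. i \<in> {1..length lam} \<and> j \<in> {1..part lam i}})"

definition young_row :: "nat list \<Rightarrow> nat \<Rightarrow> line set set" where
  "young_row lam i = {cell i j | j. j \<in> {1..part lam i}}"

definition young_rows :: "nat list \<Rightarrow> line set set set" where
  "young_rows lam = young_row lam ` {1..length lam}"

lemma cell_eq_iff: "cell i j = cell i' j' \<longleftrightarrow> i = i' \<and> j = j'"
  by (auto simp: cell_def doubleton_eq_iff)

lemma verts_line_graph_young:
  "verts (line_graph (young_graph lam)) =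
     {cell i j | i j. i \<in> {1..length lam} \<and> j \<in> {1..part lam i}}"
  by (simp add: line_graph_def young_graph_def)

lemma edges_line_graph_young:
  assumes "cell i j \<in> verts (line_graph (young_graph lam))"
    and "cell i' j' \<in> verts (line_graph (young_graph lam))"
  shows "{cell i j, cell i' j'} \<in> edges (line_graph (young_graph lam)) \<longleftrightarrow>
     (i, j) \<noteq> (i', j') \<and> (i = i' \<or> j = j')"
proof -
  have "cell i j \<inter> cell i' j' \<noteq> {} \<longleftrightarrow> i = i' \<or> j = j'"
    by (auto simp: cell_def)
  moreover have "{e, f} \<in> edges (line_graph G) \<longleftrightarrow> e \<noteq> f \<and> e \<inter> f \<noteq> {}"
    if "e \<in> edges G" "f \<in> edges G" for e f and G :: "line graph"
    using that by (auto simp: line_graph_def doubleton_eq_iff)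
  ultimately show ?thesis
    using assms by (simp add: line_graph_def cell_eq_iff)
qed

end

theory Submission
  imports Defs
begin

text \<open>Write \<open>\<lambda>\<close> for the partition. For every \<open>n\<close>, the diagram contains a set of cells with exactly
  \<open>min n \<lambda>\<^sub>i\<close> cells in row \<open>i\<close> and at most \<open>n\<close> cells in each column: the Hall-type condition for its
  existence, imposed by a set of rows with subpartition \<open>\<mu>\<close>, is the \<open>n\<close>-th inequality of
  \<open>\<mu> \<ge> \<mu>'\<close>. By Koenig's edge colouring theorem such a set is a union of \<open>n\<close> stable sets. With
  \<open>n = k\<close> it attains the upper bound for \<open>\<alpha>\<^sub>k\<close> given by the rows. With \<open>n = \<lambda>\<^bsub>k+1\<^esub>\<close> its colour
  classes, together with the remaining cells as singletons, form a stable set cover in which each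
  class \<open>K\<close> has \<open>min m |K|\<close> cells in the first \<open>m\<close> rows for \<open>m = k, k + 1\<close>. Hence \<open>\<omega>\<^sub>m\<close> is attained
  by the first \<open>m\<close> rows and the cover is saturated for both values, so that \<open>\<Delta>\<omega> = \<lambda>\<close> and
  \<open>\<Delta>\<alpha> = \<lambda>'\<close>.\<close>

section \<open>Degree-constrained subgraphs and edge colourings of bipartite graphs\<close>

lemma card_Int_modular:
  assumes "finite Z"
  shows "card (Z \<inter> (X \<union> Y)) + card (Z \<inter> (X \<inter> Y)) = card (Z \<inter> X) + card (Z \<inter> Y)"
proof -
  have "Z \<inter> (X \<union> Y) = (Z \<inter> X) \<union> (Z \<inter> Y)" "Z \<inter> (X \<inter> Y) = (Z \<inter> X) \<inter> (Z \<inter> Y)" by auto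
  then show ?thesis using card_Un_Int[of "Z \<inter> X" "Z \<inter> Y"] assms by simp
qed

text \<open>Cardinality is modular and \<open>min c\<close> is concave: the outer values, at union
  and intersection, have the same sum as the inner ones, so truncation costs them at least as
  much.\<close>

lemma min_card_submodular:
  fixes c :: nat
  assumes "finite Z"
  shows "min c (card (Z \<inter> (X \<union> Y))) + min c (card (Z \<inter> (X \<inter> Y)))
    \<le> min c (card (Z \<inter> X)) + min c (card (Z \<inter> Y))"
proof -
  have "card (Z \<inter> (X \<union> Y)) + card (Z \<inter> (X \<inter> Y)) = card (Z \<inter> X) + card (Z \<inter> Y)"
    by (rule card_Int_modular[OF assms])
  moreover have "card (Z \<inter> (X \<inter> Y)) \<le> card (Z \<inter> X)" "card (Z \<inter> (X \<inter> Y)) \<le> card (Z \<inter> Y)"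
    using assms by (auto intro!: card_mono)
  ultimately show ?thesis by linarith
qed

text \<open>Rado's argument: take a minimal edge set satisfying the condition. Each edge at a column \<open>j\<close>
  then has its row in a tight set meeting column \<open>j\<close> at most \<open>c j\<close> times, and by submodularity these
  sets are closed under union.\<close>

lemma degree_constrained_subgraph:
  fixes E :: "('a \<times> 'b) set" and r :: "'a \<Rightarrow> nat" and c :: "'b \<Rightarrow> nat"
  assumes finA: "finite A" and finB: "finite B" and E: "E \<subseteq> A \<times> B"
    and hall: "\<And>X. X \<subseteq> A \<Longrightarrow> sum r X \<le> (\<Sum>j\<in>B. min (c j) (card (E\<inverse> `` {j} \<inter> X)))"
  shows "\<exists>F\<subseteq>E. (\<forall>i\<in>A. r i \<le> card (F `` {i})) \<and> (\<forall>j\<in>B. card (F\<inverse> `` {j}) \<le> c j)"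
proof -
  \<comment> \<open>\<open>g F X\<close> is the number of edges of \<open>F\<close> at rows of
    \<open>X\<close> when column \<open>j\<close> counts for at most \<open>c j\<close>;
    \<open>P\<close> is the Hall condition for \<open>F\<close>.\<close>
  define g where "g F X = (\<Sum>j\<in>B. min (c j) (card (F\<inverse> `` {j} \<inter> X)))" for F :: "('a \<times> 'b) set" and X
  define P where "P F \<longleftrightarrow> F \<subseteq> E \<and> (\<forall>X\<subseteq>A. sum r X \<le> g F X)" for F
  have "P E" using hall by (simp add: P_def g_def)
  then obtain F where "P F" and least: "\<And>G. P G \<Longrightarrow> card F \<le> card G"
    using ex_has_least_nat[of P E card] by blast
  then have F: "F \<subseteq> E" and gF: "\<And>X. X \<subseteq> A \<Longrightarrow> sum r X \<le> g F X" by (auto simp: P_def)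
  have finF: "finite F" using finite_subset[OF subset_trans[OF F E]] finA finB by simp
  have fin_col: "finite (F\<inverse> `` {j})" for j using finF by (simp add: finite_Image)
  have col: "card (F\<inverse> `` {j}) \<le> c j" if j: "j \<in> B" for j
  proof -
    define tight where
      "tight X \<longleftrightarrow> X \<subseteq> A \<and> g F X = sum r X \<and> card (F\<inverse> `` {j} \<inter> X) \<le> c j" for X
    have tight_Un: "tight (X \<union> Y)" if "tight X" "tight Y" for X Y
    proof -
      have XY: "X \<subseteq> A" "Y \<subseteq> A" using that by (auto simp: tight_def)
      have fin: "finite X" "finite Y" using XY finA finite_subset by auto
      let ?h = "\<lambda>X j. min (c j) (card (F\<inverse> `` {j} \<inter> X))"
      have r: "sum r (X \<union> Y) + sum r (X \<inter> Y) = sum r X + sum r Y"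
        using sum.union_inter[OF fin, of r] by simp
      have le: "?h (X \<union> Y) j + ?h (X \<inter> Y) j \<le> ?h X j + ?h Y j" for j
        by (rule min_card_submodular[OF fin_col])
      then have "(\<Sum>j\<in>B. ?h (X \<union> Y) j + ?h (X \<inter> Y) j) \<le> (\<Sum>j\<in>B. ?h X j + ?h Y j)"
        by (rule sum_mono)
      then have sub: "g F (X \<union> Y) + g F (X \<inter> Y) \<le> g F X + g F Y"
        by (simp add: g_def sum.distrib)
      have lower: "sum r (X \<union> Y) \<le> g F (X \<union> Y)" "sum r (X \<inter> Y) \<le> g F (X \<inter> Y)"
        using gF[of "X \<union> Y"] gF[of "X \<inter> Y"] XY by blast+
      have eqs: "g F X = sum r X" "g F Y = sum r Y" using that by (auto simp: tight_def)
      have un: "g F (X \<union> Y) = sum r (X \<union> Y)" using r sub lower eqs by linarith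
      have "g F (X \<union> Y) + g F (X \<inter> Y) = g F X + g F Y" using r sub lower eqs by linarith
      then have "(\<Sum>j\<in>B. ?h (X \<union> Y) j + ?h (X \<inter> Y) j) = (\<Sum>j\<in>B. ?h X j + ?h Y j)"
        by (simp add: g_def sum.distrib)
      \<comment> \<open>Equality of the sums forces equality in each column. In column
        \<open>j\<close> the counts for \<open>X\<close>, \<open>Y\<close> and their intersection
        are at most \<open>c j\<close>, so by modularity the count for the union is not truncated
        either.\<close>
      then have hj: "?h (X \<union> Y) j + ?h (X \<inter> Y) j = ?h X j + ?h Y j"
        using sum_mono_inv[where f = "\<lambda>j. ?h (X \<union> Y) j + ?h (X \<inter> Y) j"
            and g = "\<lambda>j. ?h X j + ?h Y j", OF _ le j finB] by blast
      have "card (F\<inverse> `` {j} \<inter> (X \<union> Y)) + card (F\<inverse> `` {j} \<inter> (X \<inter> Y))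
          = card (F\<inverse> `` {j} \<inter> X) + card (F\<inverse> `` {j} \<inter> Y)"
        by (rule card_Int_modular[OF fin_col])
      moreover have "card (F\<inverse> `` {j} \<inter> (X \<inter> Y)) \<le> card (F\<inverse> `` {j} \<inter> X)"
        using fin_col by (auto intro!: card_mono)
      moreover have "card (F\<inverse> `` {j} \<inter> X) \<le> c j" "card (F\<inverse> `` {j} \<inter> Y) \<le> c j"
        using that by (auto simp: tight_def)
      ultimately have "card (F\<inverse> `` {j} \<inter> (X \<union> Y)) \<le> c j" using hj by linarith
      with un XY show ?thesis by (simp add: tight_def)
    qed
    have ex_tight: "\<exists>X. tight X \<and> i \<in> X" if i: "i \<in> F\<inverse> `` {j}" for i
    proof -
      define G where "G = F - {(i, j)}"
      have "card G < card F" unfolding G_def using i finF by (intro card_Diff1_less) auto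
      then have "\<not> P G" using least leD by blast
      then obtain X where X: "X \<subseteq> A" "g G X < sum r X"
        using F by (auto simp: P_def G_def not_le)
      have other: "G\<inverse> `` {j'} = F\<inverse> `` {j'}" if "j' \<noteq> j" for j' using that by (auto simp: G_def)
      have Gj: "G\<inverse> `` {j} \<inter> X = (F\<inverse> `` {j} \<inter> X) - {i}" by (auto simp: G_def)
      have split: "g H X = min (c j) (card (H\<inverse> `` {j} \<inter> X))
          + (\<Sum>j\<in>B - {j}. min (c j) (card (H\<inverse> `` {j} \<inter> X)))" for H
        unfolding g_def by (rule sum.remove[OF finB j])
      have rest: "(\<Sum>j\<in>B - {j}. min (c j) (card (G\<inverse> `` {j} \<inter> X)))
          = (\<Sum>j\<in>B - {j}. min (c j) (card (F\<inverse> `` {j} \<inter> X)))"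
        by (intro sum.cong) (auto simp: other)
      \<comment> \<open>Deleting \<open>(i, j)\<close> changes only the summand of column
        \<open>j\<close>, so the failure at \<open>X\<close> is a strict drop there. The drop is by
        one, from an untruncated count, and this makes \<open>X\<close> tight.\<close>
      have lt: "min (c j) (card (G\<inverse> `` {j} \<inter> X)) < min (c j) (card (F\<inverse> `` {j} \<inter> X))"
        using gF[OF X(1)] X(2) split[of F] split[of G] rest by linarith
      then have iX: "i \<in> X" unfolding Gj by (cases "i \<in> X") auto
      have "card (F\<inverse> `` {j} \<inter> X) = Suc (card (G\<inverse> `` {j} \<inter> X))"
        unfolding Gj using i iX fin_col by (intro card.remove) auto
      then have "card (F\<inverse> `` {j} \<inter> X) \<le> c j" "g F X = sum r X"
        using lt gF[OF X(1)] X(2) split[of F] split[of G] rest by linarith+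
      then show ?thesis using X(1) iX by (auto simp: tight_def)
    qed
    have "\<exists>X. tight X \<and> I \<subseteq> X" if "finite I" "I \<subseteq> F\<inverse> `` {j}" for I
      using that
    proof (induction I rule: finite_induct)
      case empty
      have "tight {}" by (simp add: tight_def g_def)
      then show ?case by blast
    next
      case (insert i I)
      then obtain X Y where "tight X" "I \<subseteq> X" "tight Y" "i \<in> Y" using ex_tight[of i] by blast
      then show ?case using tight_Un[of X Y] by blast
    qed
    \<comment> \<open>One tight set contains the whole column, so its bound is a bound on the degree
      of the column.\<close>
    from this[OF fin_col order_refl] obtain X where "tight X" "F\<inverse> `` {j} \<subseteq> X" by blast
    then show ?thesis by (simp add: tight_def Int_absorb2)
  qed
  have row: "r i \<le> card (F `` {i})" if "i \<in> A" for i
  proof -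
    \<comment> \<open>In the condition for a single row each column contributes at most 1, and
      nothing unless it is joined to \<open>i\<close>.\<close>
    have "r i \<le> g F {i}" using gF[of "{i}"] that by simp
    also have "\<dots> \<le> (\<Sum>j\<in>B. if j \<in> F `` {i} then 1 else 0)"
      unfolding g_def by (intro sum_mono) (auto simp: min_def)
    also have "\<dots> = card (B \<inter> F `` {i})" by (simp only: card_eq_sum sum.inter_restrict[OF finB])
    also have "\<dots> \<le> card (F `` {i})" using finF by (intro card_mono) (auto simp: finite_Image)
    finally show ?thesis .
  qed
  from row col F show ?thesis by blast
qed

section \<open>Matchings and Koenig's edge colouring theorem\<close>

lemma card_eq_sum_columns:
  assumes "finite B" "finite E" "Range E \<subseteq> B"
  shows "card E = (\<Sum>j\<in>B. card (E\<inverse> `` {j}))"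
proof -
  have E: "E = (\<Union>j\<in>B. (\<lambda>i. (i, j)) ` (E\<inverse> `` {j}))" using assms(3) by force
  have "card E = (\<Sum>j\<in>B. card ((\<lambda>i. (i, j)) ` (E\<inverse> `` {j})))"
    by (subst E, rule card_UN_disjoint) (use assms in \<open>auto simp: finite_Image\<close>)
  also have "\<dots> = (\<Sum>j\<in>B. card (E\<inverse> `` {j}))"
    by (intro sum.cong refl card_image) (auto simp: inj_on_def)
  finally show ?thesis .
qed

lemma card_eq_sum_rows:
  assumes "finite A" "finite E" "Domain E \<subseteq> A"
  shows "card E = (\<Sum>i\<in>A. card (E `` {i}))"
  using card_eq_sum_columns[of A "E\<inverse>"] assms by (simp add: card_inverse)

text \<open>The case of \<open>degree_constrained_subgraph\<close> with all bounds 1. A set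
  \<open>X\<close> of rows of degree \<open>n\<close> sends out \<open>n * card X\<close> edges and
  a column absorbs at most \<open>n\<close> of them, so \<open>X\<close> has at least
  \<open>card X\<close> neighbours.\<close>

lemma matching_of_max_degree_rows:
  fixes E :: "('a \<times> 'b) set"
  assumes fin: "finite E" and "n \<ge> 1"
    and col: "\<And>j. card (E\<inverse> `` {j}) \<le> n"
  shows "\<exists>f. inj_on f {i. card (E `` {i}) = n} \<and> (\<forall>i. card (E `` {i}) = n \<longrightarrow> (i, f i) \<in> E)"
proof -
  define A where "A = {i. card (E `` {i}) = n}"
  define B where "B = Range E"
  define E' where "E' = E \<inter> A \<times> B"
  have rowE': "E' `` {i} = E `` {i}" if "i \<in> A" for i using that by (auto simp: E'_def B_def)
  have "A \<subseteq> Domain E"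
  proof
    fix i assume "i \<in> A"
    then have "E `` {i} \<noteq> {}" using \<open>n \<ge> 1\<close> by (auto simp: A_def)
    then show "i \<in> Domain E" by blast
  qed
  then have finA: "finite A" using finite_subset[of A] fin by (simp add: finite_Domain)
  have finB: "finite B" using fin by (simp add: B_def finite_Range)
  have finE': "finite E'" using fin by (simp add: E'_def)
  have "\<exists>F\<subseteq>E'. (\<forall>i\<in>A. 1 \<le> card (F `` {i})) \<and> (\<forall>j\<in>B. card (F\<inverse> `` {j}) \<le> 1)"
  proof (rule degree_constrained_subgraph[OF finA finB])
    show "E' \<subseteq> A \<times> B" by (simp add: E'_def)
    fix X assume X: "X \<subseteq> A"
    define H where "H = E' \<inter> X \<times> UNIV"
    have finH: "finite H" using finE' by (simp add: H_def)
    have Hcol: "H\<inverse> `` {j} = E'\<inverse> `` {j} \<inter> X" for j by (auto simp: H_def)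
    have "card H = (\<Sum>i\<in>X. card (H `` {i}))"
      by (rule card_eq_sum_rows) (use finite_subset[OF X finA] finH in \<open>auto simp: H_def\<close>)
    also have "\<dots> = (\<Sum>i\<in>X. n)"
    proof (rule sum.cong[OF refl])
      fix i assume "i \<in> X"
      then have "H `` {i} = E `` {i}" using rowE'[of i] X by (auto simp: H_def)
      then show "card (H `` {i}) = n" using \<open>i \<in> X\<close> X by (auto simp: A_def)
    qed
    finally have 1: "card H = n * card X" by simp
    have "card H = (\<Sum>j\<in>B. card (H\<inverse> `` {j}))"
      by (rule card_eq_sum_columns[OF finB finH]) (auto simp: H_def E'_def)
    also have "\<dots> \<le> (\<Sum>j\<in>B. n * min 1 (card (H\<inverse> `` {j})))"
    proof (rule sum_mono)
      fix j
      have "card (H\<inverse> `` {j}) \<le> card (E\<inverse> `` {j})"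
        using fin by (intro card_mono) (auto simp: H_def E'_def finite_Image)
      also have "\<dots> \<le> n" by (rule col)
      finally show "card (H\<inverse> `` {j}) \<le> n * min 1 (card (H\<inverse> `` {j}))"
        by (cases "card (H\<inverse> `` {j}) = 0") (auto simp: min_def)
    qed
    finally have "n * card X \<le> n * (\<Sum>j\<in>B. min 1 (card (H\<inverse> `` {j})))"
      using 1 by (simp add: sum_distrib_left)
    then show "(\<Sum>i\<in>X. 1) \<le> (\<Sum>j\<in>B. min 1 (card (E'\<inverse> `` {j} \<inter> X)))"
      using \<open>n \<ge> 1\<close> by (simp add: Hcol)
  qed
  then obtain F where F: "F \<subseteq> E'" "\<And>i. i \<in> A \<Longrightarrow> 1 \<le> card (F `` {i})"
    "\<And>j. j \<in> B \<Longrightarrow> card (F\<inverse> `` {j}) \<le> 1" by blast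
  have "\<exists>j. (i, j) \<in> F" if "i \<in> A" for i
  proof -
    have "F `` {i} \<noteq> {}" using F(2)[OF that] by auto
    then show ?thesis by blast
  qed
  then obtain f where f: "\<And>i. i \<in> A \<Longrightarrow> (i, f i) \<in> F" by metis
  have "inj_on f A"
  proof (rule inj_onI)
    fix x y assume xy: "x \<in> A" "y \<in> A" "f x = f y"
    have "finite (F\<inverse> `` {f x})" using finite_subset[OF F(1) finE'] by (simp add: finite_Image)
    moreover have "f x \<in> B" using f[OF xy(1)] F(1) by (auto simp: E'_def)
    then have "card (F\<inverse> `` {f x}) \<le> Suc 0" using F(3)[of "f x"] by simp
    moreover have "x \<in> F\<inverse> `` {f x}" "y \<in> F\<inverse> `` {f x}" using f[OF xy(1)] f[OF xy(2)] xy(3) by auto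
    ultimately show "x = y" by (meson card_le_Suc0_iff_eq)
  qed
  moreover have "(i, f i) \<in> E" if "i \<in> A" for i using f[OF that] F(1) by (auto simp: E'_def)
  ultimately show ?thesis unfolding A_def by blast
qed

text \<open>The Knaster--Tarski proof of the Schroeder--Bernstein theorem merges a matching that covers
  the rows of maximum degree with one that covers the columns of maximum degree.\<close>

lemma matching_of_max_degree_vertices:
  fixes E :: "('a \<times> 'b) set"
  assumes fin: "finite E" and n: "n \<ge> 1"
    and row: "\<And>i. card (E `` {i}) \<le> n" and col: "\<And>j. card (E\<inverse> `` {j}) \<le> n"
  shows "\<exists>M\<subseteq>E. inj_on fst M \<and> inj_on snd M
    \<and> (\<forall>i. card (E `` {i}) = n \<longrightarrow> i \<in> Domain M) \<and> (\<forall>j. card (E\<inverse> `` {j}) = n \<longrightarrow> j \<in> Range M)"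
proof -
  define A where "A = {i. card (E `` {i}) = n}"
  define B where "B = {j. card (E\<inverse> `` {j}) = n}"
  obtain f where f: "inj_on f A" "\<And>i. i \<in> A \<Longrightarrow> (i, f i) \<in> E"
    using matching_of_max_degree_rows[OF fin n col] by (auto simp: A_def)
  obtain g where g: "inj_on g B" "\<And>j. j \<in> B \<Longrightarrow> (g j, j) \<in> E"
    using matching_of_max_degree_rows[of "E\<inverse>" n] fin n row by (auto simp: B_def)
  \<comment> \<open>\<open>M\<close> will use \<open>f\<close> on the rows in \<open>S\<close> and
    \<open>g\<close> on the columns in \<open>T\<close>. The fixed-point equation keeps
    \<open>S\<close> apart from the rows used by \<open>g\<close>, the choice of \<open>T\<close>
    keeps it apart from the columns used by \<open>f\<close>, and together they cover
    \<open>A\<close> and \<open>B\<close>.\<close>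
  define S where "S = lfp (\<lambda>S. A - g ` (B - f ` S))"
  define T where "T = B - f ` S"
  have "mono (\<lambda>S. A - g ` (B - f ` S))" by (intro monoI) blast
  then have S: "S = A - g ` T" unfolding T_def S_def by (rule lfp_unfold)
  have SA: "S \<subseteq> A" "S \<inter> g ` T = {}" "A \<subseteq> S \<union> g ` T" by (subst S, blast)+
  have TB: "T \<subseteq> B" "T \<inter> f ` S = {}" "B \<subseteq> T \<union> f ` S" by (auto simp: T_def)
  have inj: "inj_on f S" "inj_on g T" using inj_on_subset f(1) g(1) SA(1) TB(1) by blast+
  define M where "M = (\<lambda>i. (i, f i)) ` S \<union> (\<lambda>j. (g j, j)) ` T"
  have "M \<subseteq> E" using f(2) g(2) SA(1) TB(1) by (auto simp: M_def)
  moreover have "inj_on fst M"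
  proof (rule inj_onI)
    fix x y assume "x \<in> M" "y \<in> M" "fst x = fst y"
    then show "x = y" using SA(2) inj_onD[OF inj(2)] unfolding M_def by fastforce
  qed
  moreover have "inj_on snd M"
  proof (rule inj_onI)
    fix x y assume "x \<in> M" "y \<in> M" "snd x = snd y"
    then show "x = y" using TB(2) inj_onD[OF inj(1)] unfolding M_def by fastforce
  qed
  moreover have "A \<subseteq> Domain M" using SA(3) unfolding M_def by fastforce
  moreover have "B \<subseteq> Range M" using TB(3) unfolding M_def by fastforce
  ultimately show ?thesis by (auto simp: A_def B_def)
qed

text \<open>Induction on \<open>n\<close>: a matching through all vertices of degree
  \<open>Suc n\<close> becomes one colour class, and removing it leaves degrees at most
  \<open>n\<close>.\<close>

theorem bipartite_edge_colouring:
  fixes E :: "('a \<times> 'b) set"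
  assumes "finite E" "\<And>i. card (E `` {i}) \<le> n" "\<And>j. card (E\<inverse> `` {j}) \<le> n"
  shows "\<exists>f. (\<forall>e\<in>E. f e < n) \<and>
    (\<forall>c. inj_on fst {e \<in> E. f e = c} \<and> inj_on snd {e \<in> E. f e = c})"
  using assms
proof (induction n arbitrary: E)
  case 0
  have "E = {}"
  proof (rule ccontr)
    assume "E \<noteq> {}"
    then obtain i j where "(i, j) \<in> E" by auto
    moreover have "E `` {i} = {}" using 0(2)[of i] 0(1) by (simp add: finite_Image)
    ultimately show False by blast
  qed
  then show ?case by simp
next
  case (Suc n)
  obtain M where M: "M \<subseteq> E" "inj_on fst M" "inj_on snd M"
    "\<And>i. card (E `` {i}) = Suc n \<Longrightarrow> i \<in> Domain M"
    "\<And>j. card (E\<inverse> `` {j}) = Suc n \<Longrightarrow> j \<in> Range M"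
    using matching_of_max_degree_vertices[of E "Suc n"] Suc.prems by auto
  have row: "card ((E - M) `` {i}) \<le> n" for i
  proof (cases "card (E `` {i}) = Suc n")
    case True
    then obtain j where "(i, j) \<in> M" using M(4) by blast
    then have "(E - M) `` {i} \<subseteq> E `` {i} - {j}" "j \<in> E `` {i}" using M(1) by auto
    then show ?thesis using True Suc.prems(1)
      by (metis card_Diff_singleton card_mono diff_Suc_1 finite_Diff finite_Image)
  next
    case False
    have "card ((E - M) `` {i}) \<le> card (E `` {i})"
      using Suc.prems(1) by (intro card_mono) (auto simp: finite_Image)
    then show ?thesis using False Suc.prems(2)[of i] by linarith
  qed
  have col: "card ((E - M)\<inverse> `` {j}) \<le> n" for j
  proof (cases "card (E\<inverse> `` {j}) = Suc n")
    case True
    then obtain i where "(i, j) \<in> M" using M(5) by blast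
    then have "(E - M)\<inverse> `` {j} \<subseteq> E\<inverse> `` {j} - {i}" "i \<in> E\<inverse> `` {j}" using M(1) by auto
    then show ?thesis using True Suc.prems(1)
      by (metis card_Diff_singleton card_mono diff_Suc_1 finite_Diff finite_Image finite_converse)
  next
    case False
    have "card ((E - M)\<inverse> `` {j}) \<le> card (E\<inverse> `` {j})"
      using Suc.prems(1) by (intro card_mono) (auto simp: finite_Image)
    then show ?thesis using False Suc.prems(3)[of j] by linarith
  qed
  obtain f where f: "\<And>e. e \<in> E - M \<Longrightarrow> f e < n"
    "\<And>c. inj_on fst {e \<in> E - M. f e = c}" "\<And>c. inj_on snd {e \<in> E - M. f e = c}"
    using Suc.IH[OF finite_Diff[OF Suc.prems(1)] row col] by blast
  let ?f = "\<lambda>e. if e \<in> M then n else f e"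
  have "{e \<in> E. ?f e = c} = (if c = n then M else {e \<in> E - M. f e = c})" for c
    using f(1) M(1) by force
  then have "\<forall>c. inj_on fst {e \<in> E. ?f e = c} \<and> inj_on snd {e \<in> E. ?f e = c}"
    using M(2,3) f(2,3) by presburger
  moreover have "\<forall>e\<in>E. ?f e < Suc n" using f(1) by (auto simp: less_Suc_eq)
  ultimately show ?case by (intro exI[of _ ?f] conjI)
qed

section \<open>Partitions\<close>

lemma part_conjugate:
  assumes "sorted_wrt (\<ge>) p" "k \<ge> 1"
  shows "part (conjugate p) k = length (filter (\<lambda>a. k \<le> a) p)"
proof (cases "k \<le> part p 1")
  case True
  moreover have "[1..<Suc (part p 1)] ! (k - 1) = k"
    using True assms(2) by (subst nth_upt) auto
  ultimately show ?thesis using assms(2)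
    by (simp add: conjugate_def part_def[of "map _ _"] del: upt_Suc)
next
  case False
  have "a \<le> part p 1" if "a \<in> set p" for a
    using that assms(1) by (cases p) (auto simp: part_def)
  then have "filter (\<lambda>a. k \<le> a) p = []" using False by (force simp: filter_empty_conv)
  then show ?thesis using False by (simp add: conjugate_def part_def[of "map _ _"])
qed

lemma is_partition_conjugate: "is_partition (conjugate p)"
proof -
  have "sorted_wrt (\<ge>) (conjugate p)"
    unfolding conjugate_def sorted_wrt_map
    by (rule sorted_wrt_mono_rel[OF _ sorted_upt])
       (auto simp: length_filter_conv_card intro!: card_mono)
  moreover have "0 \<notin> set (conjugate p)"
    by (cases p) (auto simp: conjugate_def part_def filter_empty_conv)
  ultimately show ?thesis by (simp add: is_partition_def)
qed

text \<open>Both sides count the cells in the first \<open>j\<close> columns of a diagram with row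
  lengths \<open>p\<close>, by columns and by rows.\<close>

lemma sum_length_filter_le:
  "(\<Sum>k = 1..j. length (filter (\<lambda>a. k \<le> a) p)) = sum_list (map (min j) p)"
proof (induction p)
  case (Cons a p)
  have "(\<Sum>k = 1..j. if k \<le> a then 1 else 0 :: nat) = card ({1..j} \<inter> {k. k \<le> a})"
    by (simp add: sum.If_cases)
  also have "{1..j} \<inter> {k. k \<le> a} = {1..min j a}" by auto
  finally have *: "(\<Sum>k = 1..j. if k \<le> a then 1 else 0 :: nat) = min j a" by simp
  have "length (filter (\<lambda>a. k \<le> a) (a # p)) = (if k \<le> a then 1 else 0) + length (filter (\<lambda>a. k \<le> a) p)" for k
    by simp
  then show ?case using Cons * by (simp only: sum.distrib) simp
qed simp

lemma sum_part_conjugate: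
  assumes "sorted_wrt (\<ge>) p"
  shows "(\<Sum>k = 1..j. part (conjugate p) k) = sum_list (map (min j) p)"
  unfolding sum_length_filter_le[symmetric]
  by (intro sum.cong) (auto simp: part_conjugate[OF assms])

lemma sum_part_eq_sum_list_take: "(\<Sum>k = 1..n. part p k) = sum_list (take n p)"
proof (induction n)
  case (Suc n)
  then show ?case by (cases "n < length p") (auto simp: part_def take_Suc_conv_app_nth)
qed simp

text \<open>The parts that are at least \<open>j\<close> form a prefix of a nonincreasing
  list.\<close>

lemma length_filter_take_sorted:
  fixes p :: "nat list"
  assumes "sorted_wrt (\<ge>) p"
  shows "length (filter (\<lambda>a. j \<le> a) (take n p)) = min n (length (filter (\<lambda>a. j \<le> a) p))"
  using assms
proof (induction p arbitrary: n)
  case (Cons a p)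
  show ?case
  proof (cases n)
    case (Suc m)
    have "filter (\<lambda>b. j \<le> b) p = []" if "a < j" using that Cons.prems by (auto simp: filter_empty_conv)
    then show ?thesis using Cons Suc by auto
  qed simp
qed simp

text \<open>The first \<open>n\<close> rows are counted by columns: a column of height
  \<open>h\<close> meets them in \<open>min n h\<close> cells.\<close>

lemma sum_part_eq_sum_min:
  assumes "sorted_wrt (\<ge>) p" "\<forall>a\<in>set p. a \<le> m"
  shows "(\<Sum>k = 1..n. part p k) = (\<Sum>j = 1..m. min n (length (filter (\<lambda>a. j \<le> a) p)))"
proof -
  have "map (min m) (take n p) = take n p"
    using assms(2) by (intro map_idI) (auto dest: in_set_takeD)
  then show ?thesis
    unfolding sum_part_eq_sum_list_take using sum_length_filter_le[of "take n p" m]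
    by (simp add: length_filter_take_sorted[OF assms(1)])
qed

lemma part_antimono:
  assumes "is_partition p" "1 \<le> i" "i \<le> j"
  shows "part p j \<le> part p i"
proof (cases "i = j")
  case False
  then show ?thesis using assms
    by (auto simp: part_def is_partition_def sorted_wrt_iff_nth_less)
qed simp

lemma part_pos: "is_partition p \<Longrightarrow> i \<in> {1..length p} \<Longrightarrow> 1 \<le> part p i"
  by (auto simp: part_def is_partition_def Suc_le_eq) (metis Suc_le_eq Suc_pred gr0I nth_mem)

lemma map_part_upt: "map (part p) [1..<Suc (length p)] = p"
  by (rule nth_equalityI) (auto simp: part_def nth_append simp del: upt_Suc)

lemma image_mset_part: "image_mset (part p) (mset_set {1..length p}) = mset p"
proof -
  have "mset (map (part p) [1..<Suc (length p)]) = image_mset (part p) (mset_set {1..length p})"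
    by (simp only: mset_map mset_upt atLeastLessThanSuc_atLeastAtMost)
  then show ?thesis by (simp only: map_part_upt)
qed

text \<open>The only place where wideness itself is unfolded. For the subpartition \<open>mu\<close>
  formed by the rows in \<open>X\<close>, the left side is the sum of the first \<open>n\<close>
  parts of its conjugate, and the right side that of the first \<open>n\<close> parts of
  \<open>mu\<close>.\<close>

lemma wide_imp_hall:
  assumes lam: "is_partition lam" "wide lam" and X: "X \<subseteq> {1..length lam}"
  shows "(\<Sum>i\<in>X. min n (part lam i))
    \<le> (\<Sum>j = 1..part lam 1. min n (card {i \<in> X. j \<le> part lam i}))"
proof -
  \<comment> \<open>Listing the row indices in increasing order makes the row lengths
    nonincreasing.\<close>
  define mu where "mu = map (part lam) (sorted_list_of_set X)"
  have finX: "finite X" using X finite_subset by blast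
  have mset_mu: "mset mu = image_mset (part lam) (mset_set X)"
    by (simp only: mu_def mset_map sorted_list_of_mset_set[symmetric] mset_sorted_list_of_multiset)
  have "mset_set X \<subseteq># mset_set {1..length lam}" using X by (simp add: subset_imp_msubset_mset_set)
  then have "mset mu \<subseteq># mset lam"
    unfolding mset_mu image_mset_part[of lam, symmetric] by (rule image_mset_subseteq_mono)
  moreover have sorted: "sorted_wrt (\<ge>) mu"
    unfolding mu_def sorted_wrt_map
    by (rule sorted_wrt_mono_rel[OF _ sorted_sorted_list_of_set])
       (use X finX in \<open>auto intro!: part_antimono[OF lam(1)]\<close>)
  moreover have "0 \<notin> set mu" using part_pos[OF lam(1)] X finX by (force simp: mu_def)
  ultimately have "dominates mu (conjugate mu)"
    using lam(2) by (auto simp: wide_def subpartition_def is_partition_def)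
  then have "(\<Sum>k = 1..n. part (conjugate mu) k) \<le> (\<Sum>k = 1..n. part mu k)"
    by (simp add: dominates_def)
  \<comment> \<open>Summing up to \<open>part lam 1\<close>, not just to the largest part of
    \<open>mu\<close>, gives one range of columns for all \<open>X\<close>.\<close>
  also have "\<dots> = (\<Sum>j = 1..part lam 1. min n (length (filter (\<lambda>a. j \<le> a) mu)))"
    by (rule sum_part_eq_sum_min[OF sorted])
       (use X finX in \<open>auto simp: mu_def intro!: part_antimono[OF lam(1)]\<close>)
  also have "\<dots> = (\<Sum>j = 1..part lam 1. min n (card {i \<in> X. j \<le> part lam i}))"
  proof (intro sum.cong refl arg_cong2[where f = min])
    fix j
    have "length (filter (\<lambda>a. j \<le> a) mu)
        = length (filter (\<lambda>i. j \<le> part lam i) (sorted_list_of_set X))"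
      by (simp add: mu_def filter_map o_def)
    also have "\<dots> = card {i \<in> X. j \<le> part lam i}"
      using finX by (subst distinct_card[symmetric]) auto
    finally show "length (filter (\<lambda>a. j \<le> a) mu) = card {i \<in> X. j \<le> part lam i}" .
  qed
  finally show ?thesis
    unfolding sum_part_conjugate[OF sorted] using finX
    by (simp add: mu_def sum_list_distinct_conv_sum_set o_def)
qed

section \<open>Covers\<close>

text \<open>Both kinds of saturation are checked in this form, which needs no sorting of the class
  sizes.\<close>

lemma sum_part_conjugate_cover_shape:
  "(\<Sum>i = 1..k. part (conjugate (cover_shape C)) i) = (\<Sum>K\<in>C. min k (card K))"
proof -
  have "sorted_wrt (\<ge>) (cover_shape C)" by (simp add: cover_shape_def sorted_wrt_rev)
  then have "(\<Sum>i = 1..k. part (conjugate (cover_shape C)) i)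
      = sum_mset (image_mset (min k) (mset (cover_shape C)))"
    by (simp only: sum_part_conjugate mset_map[symmetric] sum_mset_sum_list)
  also have "\<dots> = (\<Sum>K\<in>C. min k (card K))"
    by (simp add: cover_shape_def image_mset.compositionality o_def sum_unfold_sum_mset)
  finally show ?thesis .
qed

lemma card_eq_sum_partition_on:
  assumes "partition_on V C" "finite V" "S \<subseteq> V"
  shows "card S = (\<Sum>K\<in>C. card (S \<inter> K))"
proof -
  have V: "V = \<Union>C" "disjoint C" using assms(1) by (auto simp: partition_on_def)
  have finC: "finite C" using assms(2) V(1) by (simp add: finite_UnionD)
  have S: "S = (\<Union>K\<in>C. S \<inter> K)" using assms(3) V(1) by auto
  show ?thesis
    by (subst S, rule card_UN_disjoint)
       (use finC finite_subset[OF assms(3,2)] V(2) in \<open>auto simp: disjoint_def\<close>)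
qed

text \<open>Weak duality: a class \<open>K\<close> meets each of the \<open>k\<close> sets at most
  once, hence their union in at most \<open>k\<close> points, and trivially in at most
  \<open>card K\<close>.\<close>

lemma card_UN_le_sum_min:
  assumes C: "partition_on V C" "finite V" and I: "\<And>i. i < k \<Longrightarrow> I i \<subseteq> V"
    and one: "\<And>i K. i < k \<Longrightarrow> K \<in> C \<Longrightarrow> card (I i \<inter> K) \<le> 1"
  shows "card (\<Union>i<k. I i) \<le> (\<Sum>K\<in>C. min k (card K))"
proof -
  have "card (\<Union>i<k. I i) = (\<Sum>K\<in>C. card ((\<Union>i<k. I i) \<inter> K))"
    using I by (intro card_eq_sum_partition_on[OF C]) auto
  also have "\<dots> \<le> (\<Sum>K\<in>C. min k (card K))"
  proof (rule sum_mono)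
    fix K assume K: "K \<in> C"
    then have "finite K" using C by (auto simp: partition_on_def intro: finite_subset[OF _ C(2)])
    then have "card ((\<Union>i<k. I i) \<inter> K) \<le> card K" by (intro card_mono) auto
    moreover have "card ((\<Union>i<k. I i) \<inter> K) \<le> (\<Sum>i<k. card (I i \<inter> K))"
      unfolding Int_UN_distrib2 UN_extend_simps by (rule card_UN_le) simp
    moreover have "(\<Sum>i<k. card (I i \<inter> K)) \<le> (\<Sum>i<k. 1)"
      by (rule sum_mono) (use one K in auto)
    ultimately show "card ((\<Union>i<k. I i) \<inter> K) \<le> min k (card K)" by simp
  qed
  finally show ?thesis .
qed

lemma card_clique_Int_indep_le_1:
  assumes "clique K E" "indep I E" "finite K"
  shows "card (I \<inter> K) \<le> 1"
proof -
  have "\<forall>x\<in>I \<inter> K. \<forall>y\<in>I \<inter> K. x = y" using assms(1,2) by (auto simp: clique_def indep_def)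
  then show ?thesis using assms(3) card_le_Suc0_iff_eq[of "I \<inter> K"] by simp
qed

text \<open>The cover certifies the upper bound by weak duality and \<open>S\<close> attains it, so
  the cover is also \<open>k\<close>-saturated.\<close>

lemma alpha_eqI:
  assumes fin: "finite (verts G)" and C: "clique_cover G C"
    and S: "k_stable G k S" "card S = (\<Sum>K\<in>C. min k (card K))"
  shows "alpha G k = (\<Sum>K\<in>C. min k (card K))"
  unfolding alpha_def
proof (rule Max_eqI)
  have "finite {S. k_stable G k S}"
    by (rule finite_subset[of _ "Pow (verts G)"]) (use fin in \<open>auto dest!: k_stable_subset\<close>)
  then show "finite (card ` {S. k_stable G k S})" by simp
  show "(\<Sum>K\<in>C. min k (card K)) \<in> card ` {S. k_stable G k S}" using S by force
  fix m assume "m \<in> card ` {S. k_stable G k S}"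
  then obtain I where I: "\<forall>i<k. I i \<subseteq> verts G \<and> indep (I i) (edges G)" "m = card (\<Union>i<k. I i)"
    by (auto simp: k_stable_def)
  have P: "partition_on (verts G) C" using C by (simp add: clique_cover_def)
  have "finite K" if "K \<in> C" for K
    using that P by (auto simp: partition_on_def intro: finite_subset[OF _ fin])
  then show "m \<le> (\<Sum>K\<in>C. min k (card K))"
    unfolding I(2) using I(1) C
    by (intro card_UN_le_sum_min[OF P fin] card_clique_Int_indep_le_1[of _ "edges G"])
       (auto simp: clique_cover_def)
qed

text \<open>The same certificate with cliques and stable sets exchanged.\<close>

lemma omega_eqI:
  assumes fin: "finite (verts G)" and C: "stable_cover G C"
    and S: "k_clique G k S" "card S = (\<Sum>K\<in>C. min k (card K))"
  shows "omega G k = (\<Sum>K\<in>C. min k (card K))"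
  unfolding omega_def
proof (rule Max_eqI)
  have "finite {S. k_clique G k S}"
    by (rule finite_subset[of _ "Pow (verts G)"]) (use fin in \<open>auto dest!: k_clique_subset\<close>)
  then show "finite (card ` {S. k_clique G k S})" by simp
  show "(\<Sum>K\<in>C. min k (card K)) \<in> card ` {S. k_clique G k S}" using S by force
  fix m assume "m \<in> card ` {S. k_clique G k S}"
  then obtain I where I: "\<forall>i<k. I i \<subseteq> verts G \<and> clique (I i) (edges G)" "m = card (\<Union>i<k. I i)"
    by (auto simp: k_clique_def)
  have P: "partition_on (verts G) C" using C by (simp add: stable_cover_def)
  have "card (I i \<inter> K) \<le> 1" if "i < k" "K \<in> C" for i K
    using card_clique_Int_indep_le_1[of "I i" "edges G" K] that I(1) C fin
    by (auto simp: stable_cover_def Int_commute intro: finite_subset)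
  then show "m \<le> (\<Sum>K\<in>C. min k (card K))"
    unfolding I(2) using I(1) by (intro card_UN_le_sum_min[OF P fin]) auto
qed

section \<open>The Young diagram of a wide partition\<close>

text \<open>As a relation between row and column indices the diagram is a bipartite edge set to
  which the results above apply; \<open>case_prod cell\<close> carries it to the line graph.\<close>

definition diagram :: "nat list \<Rightarrow> (nat \<times> nat) set" where
  "diagram lam = (SIGMA i:{1..length lam}. {1..part lam i})"

lemma finite_diagram: "finite (diagram lam)"
  by (simp add: diagram_def)

lemma verts_eq_diagram: "verts (line_graph (young_graph lam)) = case_prod cell ` diagram lam"
  unfolding verts_line_graph_young diagram_def by force

lemma inj_cell: "inj_on (case_prod cell) S"
  by (auto simp: inj_on_def cell_eq_iff)

text \<open>Injective projections mean that no two cells of \<open>M\<close> share a row or a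
  column: matchings become stable sets.\<close>

lemma indep_cells:
  assumes "M \<subseteq> diagram lam" "inj_on fst M" "inj_on snd M"
  shows "indep (case_prod cell ` M) (edges (line_graph (young_graph lam)))"
  unfolding indep_def
proof (intro ballI impI)
  fix v w assume "v \<in> case_prod cell ` M" "w \<in> case_prod cell ` M" "v \<noteq> w"
  then obtain i j i' j' where *: "v = cell i j" "w = cell i' j'" "(i, j) \<in> M" "(i', j') \<in> M" by auto
  then have "(i, j) \<noteq> (i', j')" using \<open>v \<noteq> w\<close> by auto
  then have "i \<noteq> i'" "j \<noteq> j'" using *(3,4) assms(2,3) by (force simp: inj_on_def)+
  moreover have "v \<in> verts (line_graph (young_graph lam))" "w \<in> verts (line_graph (young_graph lam))"
    using * assms(1) by (force simp: verts_eq_diagram)+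
  ultimately show "{v, w} \<notin> edges (line_graph (young_graph lam))"
    using * edges_line_graph_young by auto
qed

lemma young_row_eq: "young_row lam i = case_prod cell ` ({i} \<times> {1..part lam i})"
  by (auto simp: young_row_def)

lemma card_young_row: "card (young_row lam i) = part lam i"
  by (simp add: young_row_eq card_image inj_cell)

text \<open>Rows with an index out of range are empty, since \<open>part\<close> is 0 there. Hence
  one may speak of the first \<open>k\<close> rows even when \<open>k\<close> exceeds
  \<open>length lam\<close>.\<close>

lemma young_row_subset: "young_row lam i \<subseteq> verts (line_graph (young_graph lam))"
  by (cases "i \<in> {1..length lam}") (auto simp: young_row_def verts_line_graph_young part_def)

lemma clique_young_row: "clique (young_row lam i) (edges (line_graph (young_graph lam)))"
  unfolding clique_def
proof (intro ballI impI)
  fix v w assume *: "v \<in> young_row lam i" "w \<in> young_row lam i" "v \<noteq> w"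
  then obtain j j' where "v = cell i j" "w = cell i j'" by (auto simp: young_row_def)
  then show "{v, w} \<in> edges (line_graph (young_graph lam))"
    using * young_row_subset[of lam i] edges_line_graph_young[of i j lam i j'] by auto
qed

lemma young_row_disjoint: "i \<noteq> i' \<Longrightarrow> young_row lam i \<inter> young_row lam i' = {}"
  by (auto simp: young_row_def cell_eq_iff)

lemma young_row_nonempty: "is_partition lam \<Longrightarrow> i \<in> {1..length lam} \<Longrightarrow> young_row lam i \<noteq> {}"
  using part_pos[of lam i] by (force simp: young_row_def)

text \<open>Distinct rows are disjoint, and no row is empty because no part is zero.\<close>

lemma inj_on_young_row: "is_partition lam \<Longrightarrow> inj_on (young_row lam) {1..length lam}"
  by (rule inj_onI) (metis Int_absorb young_row_disjoint young_row_nonempty)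

lemma clique_cover_young_rows:
  assumes "is_partition lam"
  shows "clique_cover (line_graph (young_graph lam)) (young_rows lam)"
proof -
  have "partition_on (verts (line_graph (young_graph lam))) (young_rows lam)"
  proof (rule partition_onI)
    show "\<Union>(young_rows lam) = verts (line_graph (young_graph lam))"
      unfolding young_rows_def young_row_def verts_line_graph_young by blast
    show "{} \<notin> young_rows lam"
      using young_row_nonempty[OF assms] by (metis imageE young_rows_def)
    show "disjnt p q" if "p \<in> young_rows lam" "q \<in> young_rows lam" "p \<noteq> q" for p q
      using that young_row_disjoint unfolding young_rows_def disjnt_def by (metis imageE)
  qed
  then show ?thesis using clique_young_row by (auto simp: clique_cover_def young_rows_def)
qed

lemma sum_young_rows:
  assumes "is_partition lam"
  shows "(\<Sum>K\<in>young_rows lam. min k (card K)) = (\<Sum>i = 1..length lam. min k (part lam i))"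
  unfolding young_rows_def sum.reindex[OF inj_on_young_row[OF assms]] by (simp add: card_young_row)

lemma sum_part_conjugate_eq_sum_rows:
  assumes "is_partition lam"
  shows "(\<Sum>k = 1..n. part (conjugate lam) k) = (\<Sum>i = 1..length lam. min n (part lam i))"
proof -
  have "(\<Sum>k = 1..n. part (conjugate lam) k) = sum_mset (image_mset (min n) (mset lam))"
    using assms
    by (simp only: is_partition_def sum_part_conjugate mset_map[symmetric] sum_mset_sum_list)
  also have "\<dots> = (\<Sum>i = 1..length lam. min n (part lam i))"
    by (simp add: image_mset_part[of lam, symmetric] image_mset.compositionality o_def sum_unfold_sum_mset)
  finally show ?thesis .
qed

text \<open>\<open>wide_imp_hall\<close> supplies the condition of
  \<open>degree_constrained_subgraph\<close> for row demands \<open>min n (part lam i)\<close> and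
  column capacities \<open>n\<close>.\<close>

lemma wide_coloured_subdiagram:
  assumes lam: "is_partition lam" "wide lam"
  shows "\<exists>F f. F \<subseteq> diagram lam \<and> (\<forall>i\<in>{1..length lam}. card (F `` {i}) = min n (part lam i))
    \<and> (\<forall>e\<in>F. f e < n)
    \<and> (\<forall>c. inj_on fst {e \<in> F. f e = c} \<and> inj_on snd {e \<in> F. f e = c})"
proof -
  let ?A = "{1..length lam}" and ?B = "{1..part lam 1}"
  have "\<exists>F\<subseteq>diagram lam. (\<forall>i\<in>?A. min n (part lam i) \<le> card (F `` {i}))
      \<and> (\<forall>j\<in>?B. card (F\<inverse> `` {j}) \<le> n)"
  proof (rule degree_constrained_subgraph)
    show "diagram lam \<subseteq> ?A \<times> ?B"
      using part_antimono[OF lam(1), of 1] by (fastforce simp: diagram_def)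
    fix X assume X: "X \<subseteq> ?A"
    have "(diagram lam)\<inverse> `` {j} \<inter> X = {i \<in> X. j \<le> part lam i}" if "j \<in> ?B" for j
      using X that by (auto simp: diagram_def)
    then show "(\<Sum>i\<in>X. min n (part lam i)) \<le> (\<Sum>j\<in>?B. min n (card ((diagram lam)\<inverse> `` {j} \<inter> X)))"
      using wide_imp_hall[OF lam X, of n] by simp
  qed auto
  then obtain H where H: "H \<subseteq> diagram lam" "\<And>i. i \<in> ?A \<Longrightarrow> min n (part lam i) \<le> card (H `` {i})"
    "\<And>j. j \<in> ?B \<Longrightarrow> card (H\<inverse> `` {j}) \<le> n" by blast
  have finH: "finite H" using H(1) finite_diagram finite_subset by blast
  \<comment> \<open>The rows of \<open>H\<close> may be too long; trimming them to the exact demand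
    bounds all row degrees by \<open>n\<close>, so that \<open>n\<close> colours suffice.\<close>
  have "\<exists>T\<subseteq>H `` {i}. card T = min n (part lam i)" if "i \<in> ?A" for i
    using H(2)[OF that] by (meson obtain_subset_with_card_n)
  then obtain R where R: "\<And>i. i \<in> ?A \<Longrightarrow> R i \<subseteq> H `` {i}" "\<And>i. i \<in> ?A \<Longrightarrow> card (R i) = min n (part lam i)"
    by metis
  define F where "F = Sigma ?A R"
  have FH: "F \<subseteq> H" using R(1) unfolding F_def by blast
  have FR: "F `` {i} = (if i \<in> ?A then R i else {})" for i by (auto simp: F_def)
  have "\<exists>f. (\<forall>e\<in>F. f e < n) \<and> (\<forall>c. inj_on fst {e \<in> F. f e = c} \<and> inj_on snd {e \<in> F. f e = c})"
  proof (rule bipartite_edge_colouring)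
    show "finite F" using FH finH finite_subset by blast
    show "card (F `` {i}) \<le> n" for i using R(2) FR by simp
    show "card (F\<inverse> `` {j}) \<le> n" for j
    proof (cases "j \<in> ?B")
      case True
      have "card (F\<inverse> `` {j}) \<le> card (H\<inverse> `` {j})"
        using FH finH by (intro card_mono) (auto simp: finite_Image)
      then show ?thesis using H(3)[OF True] by linarith
    next
      case False
      then have "F\<inverse> `` {j} = {}"
        using FH H(1) part_antimono[OF lam(1), of 1] by (fastforce simp: diagram_def)
      then show ?thesis by simp
    qed
  qed
  moreover have "F \<subseteq> diagram lam" using FH H(1) by blast
  moreover have "\<forall>i\<in>?A. card (F `` {i}) = min n (part lam i)" using R(2) FR by simp
  ultimately show ?thesis by blast
qed

lemma wide_alpha:
  assumes lam: "is_partition lam" "wide lam"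
  shows "alpha (line_graph (young_graph lam)) k = (\<Sum>i = 1..length lam. min k (part lam i))"
proof -
  let ?G = "line_graph (young_graph lam)"
  obtain F f where F: "F \<subseteq> diagram lam"
      "\<And>i. i \<in> {1..length lam} \<Longrightarrow> card (F `` {i}) = min k (part lam i)"
      "\<And>e. e \<in> F \<Longrightarrow> f e < k"
      "\<And>c. inj_on fst {e \<in> F. f e = c}" "\<And>c. inj_on snd {e \<in> F. f e = c}"
    using wide_coloured_subdiagram[OF lam, of k] by blast
  let ?S = "case_prod cell ` F"
  have "k_stable ?G k ?S"
    unfolding k_stable_def
  \<comment> \<open>The \<open>k\<close> colour classes are the required stable sets.\<close>
  proof (intro exI[of _ "\<lambda>c. case_prod cell ` {e \<in> F. f e = c}"] conjI allI impI)
    show "case_prod cell ` {e \<in> F. f e = c} \<subseteq> verts ?G" for c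
      using F(1) by (auto simp: verts_eq_diagram)
    show "indep (case_prod cell ` {e \<in> F. f e = c}) (edges ?G)" for c
      using F(1,4,5) by (intro indep_cells) auto
    show "?S = (\<Union>c<k. case_prod cell ` {e \<in> F. f e = c})" using F(3) by auto
  qed
  moreover have "card ?S = (\<Sum>K\<in>young_rows lam. min k (card K))"
  proof -
    have "card ?S = card F" by (rule card_image[OF inj_cell])
    also have "\<dots> = (\<Sum>i = 1..length lam. card (F `` {i}))"
      by (rule card_eq_sum_rows)
         (use F(1) finite_diagram[of lam] in \<open>auto simp: diagram_def intro: finite_subset\<close>)
    finally show ?thesis using F(2) by (simp add: sum_young_rows[OF lam(1)])
  qed
  ultimately show ?thesis
    using alpha_eqI[OF _ clique_cover_young_rows[OF lam(1)]] sum_young_rows[OF lam(1)]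
    by (simp add: verts_eq_diagram finite_diagram)
qed

lemma card_top_rows: "card (\<Union>i\<in>{1..m}. young_row lam i) = (\<Sum>i = 1..m. part lam i)"
  by (subst card_UN_disjoint)
     (auto simp: card_young_row young_row_disjoint, simp add: young_row_eq)

text \<open>The colouring is taken with \<open>\<lambda>\<^bsub>k+1\<^esub>\<close> colours: every colour then occurs in each of the first
  \<open>k + 1\<close> rows, and all the cells left uncoloured lie in the first \<open>k\<close> rows.\<close>

lemma wide_stable_cover:
  assumes lam: "is_partition lam" "wide lam" and k: "k \<ge> 1"
  shows "\<exists>C. stable_cover (line_graph (young_graph lam)) C \<and>
    (\<forall>m\<in>{k, k + 1}. (\<Sum>K\<in>C. min m (card K)) = (\<Sum>i = 1..m. part lam i))"
proof -
  let ?G = "line_graph (young_graph lam)"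
  define n where "n = part lam (k + 1)"
  obtain F f where F: "F \<subseteq> diagram lam"
      "\<And>i. i \<in> {1..length lam} \<Longrightarrow> card (F `` {i}) = min n (part lam i)"
      "\<And>e. e \<in> F \<Longrightarrow> f e < n"
      "\<And>c. inj_on fst {e \<in> F. f e = c}" "\<And>c. inj_on snd {e \<in> F. f e = c}"
    using wide_coloured_subdiagram[OF lam, of n] by blast
  have finF: "finite F" using F(1) finite_diagram finite_subset by blast
  define N where "N c = {e \<in> F. f e = c}" for c
  have finN: "finite (N c)" for c using finF by (simp add: N_def)
  have top: "{1..k + 1} \<subseteq> fst ` N c" if c: "c < n" for c
  proof
    fix i assume i: "i \<in> {1..k + 1}"
    \<comment> \<open>A colour \<open>c < n\<close> exists only if \<open>n\<close> is positive, so
      row \<open>k + 1\<close> is a genuine row.\<close>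
    have "k + 1 \<le> length lam" using c by (auto simp: n_def part_def split: if_splits)
    then have il: "i \<in> {1..length lam}" using i by auto
    have "n \<le> part lam i" using part_antimono[OF lam(1)] i by (auto simp: n_def)
    then have cardF: "card (F `` {i}) = n" using F(2)[OF il] by simp
    have inj: "inj_on (\<lambda>j. f (i, j)) (F `` {i})"
      using F(4) by (force simp: inj_on_def)
    \<comment> \<open>The \<open>n\<close> cells of \<open>F\<close> in row \<open>i\<close> have
      distinct colours, so every colour occurs.\<close>
    have "(\<lambda>j. f (i, j)) ` (F `` {i}) = {..<n}"
      by (rule card_subset_eq) (use F(3) cardF card_image[OF inj] in auto)
    then obtain j where "j \<in> F `` {i}" "f (i, j) = c"
      using c by (metis (no_types, lifting) imageE lessThan_iff)
    then show "i \<in> fst ` N c" by (force simp: N_def)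
  qed
  have low: "e \<in> F" if "e \<in> diagram lam" "k < fst e" for e
  proof -
    obtain i j where e: "e = (i, j)" by force
    then have i: "i \<in> {1..length lam}" "j \<in> {1..part lam i}" "k + 1 \<le> i"
      using that by (auto simp: diagram_def)
    \<comment> \<open>A row below the first \<open>k\<close> has length at most \<open>n\<close>, so
      \<open>F\<close> contains all of it.\<close>
    have "part lam i \<le> n" using part_antimono[OF lam(1) _ i(3)] by (simp add: n_def)
    then have "card (F `` {i}) = card {1..part lam i}" using F(2)[OF i(1)] by simp
    moreover have "F `` {i} \<subseteq> {1..part lam i}" using F(1) by (auto simp: diagram_def)
    ultimately have "F `` {i} = {1..part lam i}" by (intro card_subset_eq) auto
    then show ?thesis using i(2) e by blast
  qed
  define P where "P = N ` {..<n} \<union> (\<lambda>e. {e}) ` (diagram lam - F)"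
  define C where "C = (`) (case_prod cell) ` P"
  have cover: "stable_cover ?G C"
    unfolding stable_cover_def
  proof (intro conjI ballI partition_onI)
    show "\<Union>C = verts ?G"
      using F(1,3) by (fastforce simp: C_def P_def N_def verts_eq_diagram)
    have "N c \<noteq> {}" if "c < n" for c using top[OF that] by auto
    then show "{} \<notin> C" by (auto simp: C_def P_def)
    show "disjnt p q" if pq: "p \<in> C" "q \<in> C" "p \<noteq> q" for p q
    proof -
      obtain p' q' where *: "p' \<in> P" "q' \<in> P" "p = case_prod cell ` p'" "q = case_prod cell ` q'"
        using pq by (auto simp: C_def)
      then have "p' \<noteq> q'" using pq by auto
      then have "p' \<inter> q' = {}" using * by (auto simp: P_def N_def)
      then show ?thesis using * inj_cell[of UNIV] by (simp add: disjnt_def flip: image_Int)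
    qed
    show "indep p (edges ?G)" if p: "p \<in> C" for p
    proof -
      obtain p' where "p' \<in> P" "p = case_prod cell ` p'" using p by (auto simp: C_def)
      moreover have "p' \<subseteq> diagram lam \<and> inj_on fst p' \<and> inj_on snd p'"
        using \<open>p' \<in> P\<close> F(1,4,5) by (auto simp: P_def N_def)
      ultimately show ?thesis using indep_cells by blast
    qed
  qed
  have "(\<Sum>K\<in>C. min m (card K)) = (\<Sum>i = 1..m. part lam i)" if m: "m \<in> {k, k + 1}" for m
  proof -
    define T where "T = (\<Union>i\<in>{1..m}. young_row lam i)"
    have T: "case_prod cell ` p \<inter> T = case_prod cell ` {e \<in> p. fst e \<le> m}"
      if "p \<subseteq> diagram lam" for p
      using that by (fastforce simp: T_def young_row_def diagram_def cell_eq_iff)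
    \<comment> \<open>A colour class has one cell in each of the first \<open>m\<close> rows, and an
      uncoloured singleton lies in the first \<open>k\<close> rows, hence in \<open>T\<close>.
      Summing over the classes then gives \<open>card T\<close>.\<close>
    have "min m (card K) = card (T \<inter> K)" if "K \<in> C" for K
    proof -
      obtain p where p: "p \<in> P" "K = case_prod cell ` p" using \<open>K \<in> C\<close> by (auto simp: C_def)
      have pD: "p \<subseteq> diagram lam" using p(1) F(1) by (auto simp: P_def N_def)
      have "card (T \<inter> K) = card {e \<in> p. fst e \<le> m}"
        using T[OF pD] p(2) by (simp add: Int_commute card_image[OF inj_cell])
      moreover have "card K = card p" using p(2) by (simp add: card_image[OF inj_cell])
      moreover have "card {e \<in> p. fst e \<le> m} = min m (card p)"
        using p(1) unfolding P_def
      proof (elim UnE imageE)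
        fix c assume c: "p = N c" "c \<in> {..<n}"
        have inj: "inj_on fst (N c)" using F(4) by (simp add: N_def)
        have "fst ` {e \<in> N c. fst e \<le> m} = {1..m}"
        proof
          show "fst ` {e \<in> N c. fst e \<le> m} \<subseteq> {1..m}" using pD c by (auto simp: diagram_def)
          show "{1..m} \<subseteq> fst ` {e \<in> N c. fst e \<le> m}" using top[of c] c m by fastforce
        qed
        moreover have "card (fst ` {e \<in> N c. fst e \<le> m}) = card {e \<in> N c. fst e \<le> m}"
          by (rule card_image) (rule inj_on_subset[OF inj], auto)
        ultimately have "card {e \<in> N c. fst e \<le> m} = m" by simp
        moreover have "card {e \<in> N c. fst e \<le> m} \<le> card (N c)"
          using finN by (intro card_mono) auto
        ultimately show ?thesis using c(1) by simp
      next
        fix e assume e: "p = {e}" "e \<in> diagram lam - F"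
        then have "fst e \<le> m" using low[of e] m by (cases "k < fst e") auto
        then have "{e' \<in> p. fst e' \<le> m} = {e}" using e(1) by auto
        then show ?thesis using e(1) k m by auto
      qed
      ultimately show ?thesis by simp
    qed
    then have "(\<Sum>K\<in>C. min m (card K)) = (\<Sum>K\<in>C. card (T \<inter> K))" by simp
    also have "\<dots> = card T"
      using cover young_row_subset
      by (intro card_eq_sum_partition_on[symmetric, of "verts ?G"])
         (auto simp: stable_cover_def T_def verts_eq_diagram finite_diagram)
    also have "\<dots> = (\<Sum>i = 1..m. part lam i)" unfolding T_def by (rule card_top_rows)
    finally show ?thesis .
  qed
  then show ?thesis using cover by blast
qed

section \<open>The values of \<omega> and the conclusion\<close>

lemma k_clique_top_rows:
  "k_clique (line_graph (young_graph lam)) k (\<Union>i\<in>{1..k}. young_row lam i)"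
proof -
  \<comment> \<open>Rows are numbered from 1, the cliques in \<open>k_clique\<close> from 0.\<close>
  have "{1..k} = Suc ` {..<k}" by (simp add: image_Suc_lessThan)
  then show ?thesis
    unfolding k_clique_def using young_row_subset clique_young_row
    by (intro exI[of _ "\<lambda>i. young_row lam (Suc i)"]) auto
qed

lemma omega_eq_sum_part:
  assumes "stable_cover (line_graph (young_graph lam)) C"
    and "(\<Sum>K\<in>C. min m (card K)) = (\<Sum>i = 1..m. part lam i)"
  shows "omega (line_graph (young_graph lam)) m = (\<Sum>i = 1..m. part lam i)"
  using omega_eqI[OF _ assms(1) k_clique_top_rows] card_top_rows[of lam m] assms(2)
  by (simp add: verts_eq_diagram finite_diagram)

theorem theorem2:
  fixes lam :: "nat list"
  assumes "is_partition lam" and "wide lam"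
  shows "completely_saturated_clique_cover (line_graph (young_graph lam)) (young_rows lam)
    \<and> delta_conjugacy (line_graph (young_graph lam))
    \<and> t_phenomenon (line_graph (young_graph lam))"
proof -
  let ?G = "line_graph (young_graph lam)"
  have rows: "saturated_clique_cover ?G k (young_rows lam)" for k
    unfolding saturated_clique_cover_def sum_part_conjugate_cover_shape
    using clique_cover_young_rows wide_alpha sum_young_rows assms by simp
  have omega: "omega ?G k = (\<Sum>i = 1..k. part lam i)" for k
  \<comment> \<open>\<open>wide_stable_cover\<close> is stated for positive \<open>k\<close>, so the
    value at 0 is treated separately.\<close>
  proof (cases k)
    case 0
    then show ?thesis by (simp add: omega_0)
  next
    case (Suc m)
    then obtain C where "stable_cover ?G C" "(\<Sum>K\<in>C. min k (card K)) = (\<Sum>i = 1..k. part lam i)"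
      using wide_stable_cover[OF assms, of k] by auto
    then show ?thesis by (rule omega_eq_sum_part)
  qed
  have delta_omega: "delta_omega ?G k = part lam k" if "k \<ge> 1" for k
    using that by (cases k) (auto simp: delta_omega_def omega)
  have alpha: "alpha ?G k = (\<Sum>i = 1..k. part (conjugate lam) i)" for k
    using wide_alpha[OF assms] sum_part_conjugate_eq_sum_rows[OF assms(1)] by simp
  have delta_alpha: "delta_alpha ?G k = part (conjugate lam) k" if "k \<ge> 1" for k
    using that by (cases k) (auto simp: delta_alpha_def alpha)
  have "delta_conjugacy ?G"
    unfolding delta_conjugacy_def
    using assms(1) is_partition_conjugate[of lam]
    by (intro conjI, (auto simp: delta_omega delta_alpha intro!: part_antimono)[2])
       (rule exI[of _ lam], rule exI[of _ "conjugate lam"], auto simp: delta_omega delta_alpha)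
  moreover have "t_phenomenon ?G"
    unfolding t_phenomenon_def
  proof (intro allI impI conjI)
    fix k :: nat assume "k \<ge> 1"
    show "\<exists>C. saturated_clique_cover ?G k C \<and> saturated_clique_cover ?G (k + 1) C"
      using rows by blast
    obtain C where "stable_cover ?G C"
        "\<forall>m\<in>{k, k + 1}. (\<Sum>K\<in>C. min m (card K)) = (\<Sum>i = 1..m. part lam i)"
      \<comment> \<open>Unlike the rows, which serve every \<open>k\<close>, this cover depends on
        \<open>k\<close>.\<close>
      using wide_stable_cover[OF assms \<open>k \<ge> 1\<close>] by blast
    then show "\<exists>C. saturated_stable_cover ?G k C \<and> saturated_stable_cover ?G (k + 1) C"
      unfolding saturated_stable_cover_def sum_part_conjugate_cover_shape omega by auto
  qed
  ultimately show ?thesis using rows by (simp add: completely_saturated_clique_cover_def)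
qed

end
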